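(* Let $(X,d)$ be a (nonempty) complete metric space, $\Lambda$ a (nonempty) compact metric space, and $w:\Lambda\times X\to X$ a weakly$^*$ hyperbolic iterated function system. Assume that $(\mathcal K(X),d_H)$ is $\varepsilon$-chainable for every $\varepsilon>0$. Then there is a set $K\in\mathcal K(X)$ which is a global attractor of $w$, that is, $\mathcal F^n(B)\to K$ in the Hausdorff metric for every $B\in\mathcal K(X)$, and which is also invariant, that is, $\mathcal F(K)=K$.
   Context: An iterated function system (IFS) is a continuous map $w:\Lambda\times X\to X$; put $w_\lambda(x):=w(\lambda,x)$ and $w_{\lambda_1\dots\lambda_n}:=w_{\lambda_1}\circ\cdots\circ w_{\lambda_n}$. $\Omega:=\Lambda^{\mathbb N}$ is the space of infinite words $\sigma=(\sigma_1,\sigma_2,\dots)$. $w$ is weakly$^*$ hyperbolic if for all $x,y\in X$ and $\sigma\in\Omega$, $\lim_{n\to\infty}d(w_{\sigma_1\dots\sigma_n}(x),w_{\sigma_1\dots\sigma_n}(y))=0$, with convergence uniform in $\Omega$ and locally uniform in $X$ in the following sense: there exists $\eta>0$ such that for every $\varepsilon>0$ there exists $n_0=n_0(\varepsilon)$ such that if $n\ge n_0$ then $d(w_{\sigma_1\dots\sigma_n}(x),w_{\sigma_1\dots\sigma_n}(y))<\varepsilon$ for all $\sigma\in\Omega$ and all $x,y\in X$ with $d(x,y)<\eta$. $\mathcal K(X)$ is the family of nonempty compact subsets of $X$ with the Hausdorff metric $d_H(A,B)=\sup\{d(a,B),d(b,A):a\in A,b\in B\}$, where $d(x,F)=\inf_{y\in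 F}d(x,y)$. The Hutchinson-Barnsley operator is $\mathcal F:\mathcal K(X)\to\mathcal K(X)$, $\mathcal F(A)=\bigcup_{\lambda\in\Lambda}w_\lambda(A)=w(\Lambda\times A)$. A metric space $(M,\rho)$ is $\varepsilon$-chainable if for all $x,y\in M$ there is a finite sequence $x_0=x,x_1,\dots,x_n=y$ in $M$ with $\rho(x_i,x_{i+1})<\varepsilon$ for $i=0,\dots,n-1$. *)

theory Defs
  imports "HOL-Analysis.Analysis"
begin

definition ifs :: "('l::metric_space \<times> 'a::metric_space \<Rightarrow> 'a) \<Rightarrow> bool" where
  "ifs w \<longleftrightarrow> continuous_on UNIV w"

text \<open>Infinite words are indexed from 0, so \<open>word_map w \<sigma> n\<close> is the composition
  of the maps of the first \<open>n\<close> letters \<open>\<sigma> 0, \<dots>, \<sigma> (n - 1)\<close>, with the map of the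
  last of these letters applied first.\<close>

primrec word_map :: "('l \<times> 'a \<Rightarrow> 'a) \<Rightarrow> (nat \<Rightarrow> 'l) \<Rightarrow> nat \<Rightarrow> 'a \<Rightarrow> 'a" where
  "word_map w \<sigma> 0 = id"
| "word_map w \<sigma> (Suc n) = word_map w \<sigma> n \<circ> (\<lambda>x. w (\<sigma> n, x))"

definition weakly_star_hyperbolic :: "('l \<times> 'a::metric_space \<Rightarrow> 'a) \<Rightarrow> bool" where
  "weakly_star_hyperbolic w \<longleftrightarrow>
     (\<forall>x y \<sigma>. (\<lambda>n. dist (word_map w \<sigma> n x) (word_map w \<sigma> n y)) \<longlonglongrightarrow> 0) \<and>
     (\<exists>\<eta>>0. \<forall>\<epsilon>>0. \<exists>n0. \<forall>n\<ge>n0. \<forall>\<sigma> x y.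
        dist x y < \<eta> \<longrightarrow> dist (word_map w \<sigma> n x) (word_map w \<sigma> n y) < \<epsilon>)"

definition nonempty_compacts :: "'a::metric_space set set" where
  "nonempty_compacts = {A. A \<noteq> {} \<and> compact A}"

text \<open>Only meaningful for nonempty bounded sets: otherwise the supremum or \<^const>\<open>infdist\<close>
  may take a junk value.\<close>

definition hausdorff_dist :: "'a::metric_space set \<Rightarrow> 'a set \<Rightarrow> real" where
  "hausdorff_dist A B = Sup ((\<lambda>a. infdist a B) ` A \<union> (\<lambda>b. infdist b A) ` B)"

definition hutchinson :: "('l \<times> 'a \<Rightarrow> 'a) \<Rightarrow> 'a set \<Rightarrow> 'a set" where
  "hutchinson w A = (\<Union>l. (\<lambda>x. w (l, x)) ` A)"

definition chainable :: "real \<Rightarrow> 'b set \<Rightarrow> ('b \<Rightarrow> 'b \<Rightarrow> real) \<Rightarrow> bool" where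
  "chainable \<epsilon> M \<rho> \<longleftrightarrow>
     (\<forall>x\<in>M. \<forall>y\<in>M. \<exists>n c. c 0 = x \<and> c n = y \<and> (\<forall>i\<le>n. c i \<in> M) \<and>
        (\<forall>i<n. \<rho> (c i) (c (Suc i)) < \<epsilon>))"

definition global_attractor :: "('l \<times> 'a::metric_space \<Rightarrow> 'a) \<Rightarrow> 'a set \<Rightarrow> bool" where
  "global_attractor w K \<longleftrightarrow>
     K \<in> nonempty_compacts \<and>
     (\<forall>B\<in>nonempty_compacts. (\<lambda>n. hausdorff_dist ((hutchinson w ^^ n) B) K) \<longlonglongrightarrow> 0)"

lemma hutchinson_eq_image: "hutchinson w A = w ` (UNIV \<times> A)"
  by (auto simp: hutchinson_def)

lemma hutchinson_nonempty_compacts: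
  fixes w :: "'l::metric_space \<times> 'a::metric_space \<Rightarrow> 'a"
  assumes "compact (UNIV :: 'l set)" "ifs w" "A \<in> nonempty_compacts"
  shows "hutchinson w A \<in> nonempty_compacts"
  using assms unfolding hutchinson_eq_image nonempty_compacts_def ifs_def
  by (auto intro!: compact_continuous_image compact_Times intro: continuous_on_subset)

lemma hausdorff_dist_le_iff:
  fixes A B :: "'a::metric_space set"
  assumes A: "A \<in> nonempty_compacts" and B: "B \<in> nonempty_compacts"
  shows "hausdorff_dist A B \<le> r \<longleftrightarrow>
    (\<forall>a\<in>A. infdist a B \<le> r) \<and> (\<forall>b\<in>B. infdist b A \<le> r)"
proof -
  have "bdd_above ((\<lambda>x. infdist x T) ` S)"
    if "S \<in> nonempty_compacts" for S T :: "'a set"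
  proof -
    have "compact ((\<lambda>x. infdist x T) ` S)"
      using that unfolding nonempty_compacts_def
      by (auto intro!: compact_continuous_image continuous_intros)
    then show ?thesis
      by (rule bounded_imp_bdd_above[OF compact_imp_bounded])
  qed
  with A B have "bdd_above ((\<lambda>a. infdist a B) ` A \<union> (\<lambda>b. infdist b A) ` B)"
    by (simp add: bdd_above_Un)
  moreover have "(\<lambda>a. infdist a B) ` A \<union> (\<lambda>b. infdist b A) ` B \<noteq> {}"
    using A by (simp add: nonempty_compacts_def)
  ultimately show ?thesis
    unfolding hausdorff_dist_def by (subst cSup_le_iff) auto
qed

end

theory Submission
  imports Defs
begin

text \<open>
  Write \<open>F\<close> for the Hutchinson--Barnsley operator. Since \<open>F\<^sup>n A\<close> is the union of the images of
  \<open>A\<close> under all words of length \<open>n\<close>, the uniform part of weak* hyperbolicity carries over to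
  compact sets: there is \<open>\<eta> > 0\<close> such that \<open>F\<^sup>n A\<close> and \<open>F\<^sup>n B\<close> are uniformly close for large
  \<open>n\<close> whenever \<open>A\<close> and \<open>B\<close> are at Hausdorff distance less than \<open>\<eta>\<close>
  (\<open>uniform_contraction_funpow\<close>). Adding this up along an \<open>\<eta>\<close>-chain shows that \<open>F\<^sup>n A\<close> and
  \<open>F\<^sup>n B\<close> approach each other for any two nonempty compact sets
  (\<open>hausdorff_dist_funpow_tendsto_0\<close>). It remains to find one orbit that converges.

  Let \<open>N\<close> be such that \<open>F\<^sup>N\<close> brings sets that are \<open>\<eta>\<close>-close to within \<open>\<eta>/2\<close>. Far along any orbit
  there is a set \<open>C\<close> that is \<open>\<eta>/2\<close>-close to each of \<open>C, F C, \<dots>, F\<^sup>N C\<close>. Then \<open>C\<close> is \<open>\<eta>\<close>-close to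
  its whole orbit: if it is \<open>\<eta>\<close>-close to \<open>F\<^sup>m C\<close>, then \<open>F\<^sup>N C\<close>, which is \<open>\<eta>/2\<close>-close to \<open>C\<close>, is
  \<open>\<eta>/2\<close>-close to \<open>F\<^sup>N\<^sup>+\<^sup>m C\<close> (\<open>orbit_stays_near\<close>). Hence the orbit of \<open>C\<close> is Cauchy.

  The completeness of the hyperspace is replaced by a direct construction of the limit. As
  the orbit of \<open>C\<close> is Cauchy, the closure \<open>D\<close> of its union is compact, and \<open>F D \<subseteq> D\<close>. So the
  sets \<open>F\<^sup>n D\<close> decrease, and they converge to their intersection \<open>K\<close>; hence so do all orbits.
  Finally, \<open>F K \<subseteq> K\<close>, and as \<open>F\<^sup>n K\<close> stays inside the closed set \<open>F K\<close> but converges to \<open>K\<close>,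
  also \<open>K \<subseteq> F K\<close>.
\<close>

section \<open>The Hausdorff distance between compact sets\<close>

lemma hausdorff_dist_commute: "hausdorff_dist A B = hausdorff_dist B A"
  by (simp add: hausdorff_dist_def Un_commute)

text \<open>Between compact sets, the distance from a point to a set is attained, so estimates of the
  Hausdorff distance can be made by matching points.\<close>

lemma hausdorff_dist_le_iff_matching:
  fixes A B :: "'a::metric_space set"
  assumes A: "A \<in> nonempty_compacts" and B: "B \<in> nonempty_compacts"
  shows "hausdorff_dist A B \<le> r \<longleftrightarrow>
    (\<forall>a\<in>A. \<exists>b\<in>B. dist a b \<le> r) \<and> (\<forall>b\<in>B. \<exists>a\<in>A. dist a b \<le> r)"
proof -
  have "infdist x T \<le> r \<longleftrightarrow> (\<exists>t\<in>T. dist x t \<le> r)" if "T \<in> nonempty_compacts" for x :: 'a and T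
  proof
    assume "infdist x T \<le> r"
    moreover obtain t where "t \<in> T" "infdist x T = dist x t"
    proof -
      have T: "T \<noteq> {}" "compact T"
        using \<open>T \<in> nonempty_compacts\<close> by (auto simp: nonempty_compacts_def)
      moreover have "continuous_on T (dist x)"
        by (intro continuous_intros)
      ultimately obtain t where "t \<in> T" "\<And>s. s \<in> T \<Longrightarrow> dist x t \<le> dist x s"
        using continuous_attains_inf by metis
      moreover from this have "dist x t \<le> infdist x T"
        using T by (auto simp: infdist_notempty intro!: cINF_greatest)
      ultimately show ?thesis
        using that infdist_le[of t T x] by force
    qed
    ultimately show "\<exists>t\<in>T. dist x t \<le> r" by auto
  qed (meson infdist_le order_trans)
  with A B show ?thesis
    by (simp add: hausdorff_dist_le_iff dist_commute)
qed

lemma hausdorff_dist_nonneg: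
  assumes "A \<in> nonempty_compacts" "B \<in> nonempty_compacts"
  shows "0 \<le> hausdorff_dist A B"
proof -
  obtain a where "a \<in> A" using assms by (auto simp: nonempty_compacts_def)
  then obtain b where "dist a b \<le> hausdorff_dist A B"
    using hausdorff_dist_le_iff_matching[OF assms, of "hausdorff_dist A B"] by auto
  then show ?thesis
    using zero_le_dist order_trans by blast
qed

lemma hausdorff_dist_triangle:
  assumes A: "A \<in> nonempty_compacts" and B: "B \<in> nonempty_compacts" and C: "C \<in> nonempty_compacts"
  shows "hausdorff_dist A C \<le> hausdorff_dist A B + hausdorff_dist B C"
proof -
  have AB: "\<forall>a\<in>A. \<exists>b\<in>B. dist a b \<le> hausdorff_dist A B"
           "\<forall>b\<in>B. \<exists>a\<in>A. dist a b \<le> hausdorff_dist A B"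
    using hausdorff_dist_le_iff_matching[OF A B, of "hausdorff_dist A B"] by auto
  have BC: "\<forall>b\<in>B. \<exists>c\<in>C. dist b c \<le> hausdorff_dist B C"
           "\<forall>c\<in>C. \<exists>b\<in>B. dist b c \<le> hausdorff_dist B C"
    using hausdorff_dist_le_iff_matching[OF B C, of "hausdorff_dist B C"] by auto
  show ?thesis
    unfolding hausdorff_dist_le_iff_matching[OF A C]
    using AB BC by (meson add_mono dist_triangle order_trans)
qed

text \<open>All sets from the \<open>n\<close>-th on are \<open>\<epsilon>\<close>-close to \<open>S n\<close>, so an \<open>\<epsilon>\<close>-net of the finite union of
  the first ones is a \<open>2\<epsilon>\<close>-net of the whole union. Thus the union is totally bounded, which in
  a complete space makes its closure compact.\<close>

lemma compact_closure_Union_if_Cauchy: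
  fixes S :: "nat \<Rightarrow> 'a::complete_space set"
  assumes S: "\<And>n. S n \<in> nonempty_compacts"
    and Cauchy: "\<And>\<epsilon>. \<epsilon> > 0 \<Longrightarrow> \<exists>n. \<forall>m\<ge>n. hausdorff_dist (S n) (S m) \<le> \<epsilon>"
  shows "compact (closure (\<Union>n. S n))"
  unfolding compact_eq_totally_bounded
proof (intro conjI allI impI)
  show "complete (closure (\<Union>n. S n))"
    by (simp add: complete_eq_closed)
next
  fix e :: real
  assume e: "0 < e"
  obtain n where n: "hausdorff_dist (S n) (S m) \<le> e / 4" if "m \<ge> n" for m
    using Cauchy[of "e / 4"] e by auto
  have "compact (\<Union>m\<le>n. S m)"
    using S by (intro compact_UN) (auto simp: nonempty_compacts_def)
  then obtain k where "finite k" and k: "(\<Union>m\<le>n. S m) \<subseteq> (\<Union>x\<in>k. ball x (e / 4))"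
    using e unfolding compact_eq_totally_bounded by (meson divide_pos_pos zero_less_numeral)
  have near: "\<exists>y\<in>(\<Union>m\<le>n. S m). dist y x \<le> e / 4" if "x \<in> S m" for x m
  proof (cases "m \<le> n")
    case True
    with that e show ?thesis by (intro bexI[of _ x]) auto
  next
    case False
    then have "\<exists>y\<in>S n. dist y x \<le> e / 4"
      using n[of m] that hausdorff_dist_le_iff_matching[OF S[of n] S[of m], of "e / 4"] by auto
    then show ?thesis by auto
  qed
  have "closure (\<Union>n. S n) \<subseteq> (\<Union>x\<in>k. ball x e)"
  proof
    fix x assume "x \<in> closure (\<Union>n. S n)"
    then obtain m z where z: "z \<in> S m" "dist z x < e / 4"
      using e unfolding closure_approachable by (metis UN_E divide_pos_pos zero_less_numeral)
    obtain y where y: "y \<in> (\<Union>m\<le>n. S m)" "dist y z \<le> e / 4"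
      using near[OF z(1)] by blast
    then obtain p where p: "p \<in> k" "dist p y < e / 4"
      using k by (auto simp: subset_iff)
    have "dist p x < e"
      using dist_triangle[of p x y] dist_triangle[of y x z] z y p e by simp
    with p show "x \<in> (\<Union>x\<in>k. ball x e)" by auto
  qed
  with \<open>finite k\<close> show "\<exists>k. finite k \<and> closure (\<Union>n. S n) \<subseteq> (\<Union>x\<in>k. ball x e)" by blast
qed

lemma decreasing_compacts_Inter_nonempty:
  fixes S :: "nat \<Rightarrow> 'a::metric_space set"
  assumes S: "\<And>n. compact (S n)" "\<And>n. S n \<noteq> {}"
    and dec: "\<And>m n. m \<le> n \<Longrightarrow> S n \<subseteq> S m"
  shows "(\<Inter>n. S n) \<noteq> {}"
proof -
  have "S 0 \<inter> (\<Inter>n. S n) \<noteq> {}"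
  proof (rule compact_imp_fip_image)
    fix I :: "nat set"
    assume "finite I"
    then have "S (Max (insert 0 I)) \<subseteq> S 0 \<inter> (\<Inter>n\<in>I. S n)"
      by (intro Int_greatest INT_greatest dec Max_ge) auto
    with S(2) show "S 0 \<inter> (\<Inter>n\<in>I. S n) \<noteq> {}" by blast
  qed (use S in \<open>auto simp: compact_imp_closed\<close>)
  then show ?thesis by auto
qed

text \<open>Were the distance from \<open>S n\<close> to the intersection not to tend to \<open>0\<close>, the points of \<open>S n\<close>
  at distance at least \<open>\<epsilon>\<close> from the intersection would again form a decreasing sequence of
  nonempty compact sets. A common point of these would lie in the intersection of the \<open>S n\<close> and
  at positive distance from it.\<close>

lemma decreasing_compacts_tendsto_Inter:
  fixes S :: "nat \<Rightarrow> 'a::metric_space set"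
  assumes S: "\<And>n. S n \<in> nonempty_compacts"
    and dec: "\<And>m n. m \<le> n \<Longrightarrow> S n \<subseteq> S m"
  shows "(\<Inter>n. S n) \<in> nonempty_compacts"
    and "(\<lambda>n. hausdorff_dist (S n) (\<Inter>n. S n)) \<longlonglongrightarrow> 0"
proof -
  let ?K = "\<Inter>n. S n"
  have "?K \<noteq> {}"
    using S by (intro decreasing_compacts_Inter_nonempty dec) (auto simp: nonempty_compacts_def)
  moreover have "compact ?K"
  proof -
    have "closed ?K"
      using S by (intro closed_INT) (auto simp: nonempty_compacts_def compact_imp_closed)
    then have "compact (S 0 \<inter> ?K)"
      using S[of 0] by (auto simp: nonempty_compacts_def intro: compact_Int_closed)
    moreover have "S 0 \<inter> ?K = ?K" by blast
    ultimately show ?thesis by simp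
  qed
  ultimately show K: "?K \<in> nonempty_compacts"
    by (simp add: nonempty_compacts_def)
  show "(\<lambda>n. hausdorff_dist (S n) ?K) \<longlonglongrightarrow> 0"
  proof (rule LIMSEQ_I)
    fix e :: real
    assume e: "0 < e"
    define T where "T n = S n \<inter> {x. e / 2 \<le> infdist x ?K}" for n
    have "closed {x. e / 2 \<le> infdist x ?K}"
      by (intro closed_Collect_le continuous_intros)
    then have "compact (T n)" for n
      unfolding T_def using S by (intro compact_Int_closed) (auto simp: nonempty_compacts_def)
    moreover have "(\<Inter>n. T n) = {}"
      using e by (auto simp: T_def)
    moreover have "T n \<subseteq> T m" if "m \<le> n" for m n
      using dec[OF that] by (auto simp: T_def)
    ultimately obtain n0 where n0: "T n0 = {}"
      using decreasing_compacts_Inter_nonempty[of T] by blast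
    have "norm (hausdorff_dist (S n) ?K - 0) < e" if "n \<ge> n0" for n
    proof -
      have "infdist x ?K \<le> e / 2" if "x \<in> S n" for x
        using n0 dec[OF \<open>n \<ge> n0\<close>] that by (fastforce simp: T_def)
      moreover have "infdist x (S n) \<le> e / 2" if "x \<in> ?K" for x
        using that e by (simp add: infdist_zero)
      ultimately have "hausdorff_dist (S n) ?K \<le> e / 2"
        using hausdorff_dist_le_iff[OF S K] by blast
      with hausdorff_dist_nonneg[OF S K, of n] e show ?thesis by simp
    qed
    then show "\<exists>n0. \<forall>n\<ge>n0. norm (hausdorff_dist (S n) ?K - 0) < e" by blast
  qed
qed

section \<open>Iterates of the Hutchinson--Barnsley operator\<close>

lemma hutchinson_mono: "A \<subseteq> B \<Longrightarrow> hutchinson w A \<subseteq> hutchinson w B"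
  by (auto simp: hutchinson_def)

lemma funpow_hutchinson_nonempty_compacts:
  fixes w :: "'l::metric_space \<times> 'a::metric_space \<Rightarrow> 'a"
  assumes "compact (UNIV :: 'l set)" "ifs w" "A \<in> nonempty_compacts"
  shows "(hutchinson w ^^ n) A \<in> nonempty_compacts"
  by (induction n) (use assms in \<open>auto intro: hutchinson_nonempty_compacts\<close>)

lemma funpow_hutchinson_antimono:
  assumes "hutchinson w A \<subseteq> A" "m \<le> n"
  shows "(hutchinson w ^^ n) A \<subseteq> (hutchinson w ^^ m) A"
proof -
  have "(hutchinson w ^^ Suc k) A \<subseteq> (hutchinson w ^^ k) A" for k
    by (induction k) (use assms(1) in \<open>auto dest: hutchinson_mono[of _ _ w]\<close>)
  then show ?thesis
    using \<open>m \<le> n\<close> by (rule lift_Suc_antimono_le)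
qed

lemma word_map_fun_upd: "n \<le> m \<Longrightarrow> word_map w (\<sigma>(m := l)) n = word_map w \<sigma> n"
  by (induction n) auto

text \<open>Each iterate prepends a map on the outside, while a longer word adds its last letter on the
  inside; so the induction peels \<open>F\<^sup>n\<^sup>+\<^sup>1 A = F\<^sup>n (F A)\<close>.\<close>

lemma funpow_hutchinson_eq_UN_word_map:
  "(hutchinson w ^^ n) A = (\<Union>\<sigma>. word_map w \<sigma> n ` A)"
proof (induction n arbitrary: A)
  case 0
  show ?case by simp
next
  case (Suc n)
  have "(hutchinson w ^^ Suc n) A = (\<Union>\<sigma>. word_map w \<sigma> n ` hutchinson w A)"
    by (simp add: funpow_Suc_right Suc del: funpow.simps)
  also have "\<dots> = (\<Union>\<sigma>. word_map w \<sigma> (Suc n) ` A)"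
  proof (intro equalityI subsetI)
    fix y assume "y \<in> (\<Union>\<sigma>. word_map w \<sigma> n ` hutchinson w A)"
    then obtain \<sigma> l x where "x \<in> A" "y = word_map w \<sigma> n (w (l, x))"
      by (auto simp: hutchinson_def)
    then have "y = word_map w (\<sigma>(n := l)) (Suc n) x"
      by (simp add: word_map_fun_upd)
    with \<open>x \<in> A\<close> show "y \<in> (\<Union>\<sigma>. word_map w \<sigma> (Suc n) ` A)" by blast
  qed (fastforce simp: hutchinson_def)
  finally show ?case .
qed

text \<open>Words of length \<open>n\<close> send matched points of \<open>A\<close> and \<open>B\<close> to matched points of \<open>F\<^sup>n A\<close> and
  \<open>F\<^sup>n B\<close>.\<close>

lemma uniform_contraction_funpow:
  fixes w :: "'l::metric_space \<times> 'a::metric_space \<Rightarrow> 'a"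
  assumes compact: "compact (UNIV :: 'l set)" and w: "ifs w"
    and hyp: "weakly_star_hyperbolic w"
  obtains \<eta> where "\<eta> > 0"
    and "\<And>\<epsilon>. \<epsilon> > 0 \<Longrightarrow> \<exists>n0. \<forall>n\<ge>n0. \<forall>A\<in>nonempty_compacts. \<forall>B\<in>nonempty_compacts.
      hausdorff_dist A B < \<eta> \<longrightarrow>
      hausdorff_dist ((hutchinson w ^^ n) A) ((hutchinson w ^^ n) B) \<le> \<epsilon>"
proof -
  obtain \<eta> where \<eta>: "\<eta> > 0"
    and unif: "\<And>\<epsilon>. \<epsilon> > 0 \<Longrightarrow> \<exists>n0. \<forall>n\<ge>n0. \<forall>\<sigma> x y.
      dist x y < \<eta> \<longrightarrow> dist (word_map w \<sigma> n x) (word_map w \<sigma> n y) < \<epsilon>"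
    using hyp unfolding weakly_star_hyperbolic_def by blast
  show ?thesis
  proof (rule that[OF \<eta>])
    fix \<epsilon> :: real
    assume "\<epsilon> > 0"
    from unif[OF this] obtain n0 where n0: "\<And>n \<sigma> x y. n \<ge> n0 \<Longrightarrow>
        dist x y < \<eta> \<Longrightarrow> dist (word_map w \<sigma> n x) (word_map w \<sigma> n y) < \<epsilon>"
      by blast
    have "hausdorff_dist ((hutchinson w ^^ n) A) ((hutchinson w ^^ n) B) \<le> \<epsilon>"
      if n: "n \<ge> n0" and A: "A \<in> nonempty_compacts" and B: "B \<in> nonempty_compacts"
        and AB: "hausdorff_dist A B < \<eta>" for n A B
    proof -
      have match: "\<forall>a\<in>A. \<exists>b\<in>B. dist a b < \<eta>" "\<forall>b\<in>B. \<exists>a\<in>A. dist a b < \<eta>"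
        using hausdorff_dist_le_iff_matching[OF A B, of "hausdorff_dist A B"] AB
        by (meson order_refl le_less_trans)+
      have Fn: "(hutchinson w ^^ n) A \<in> nonempty_compacts" "(hutchinson w ^^ n) B \<in> nonempty_compacts"
        using A B compact w by (auto intro: funpow_hutchinson_nonempty_compacts)
      show ?thesis
        unfolding hausdorff_dist_le_iff_matching[OF Fn]
      proof (intro conjI ballI)
        fix p assume "p \<in> (hutchinson w ^^ n) A"
        then obtain \<sigma> a where a: "a \<in> A" "p = word_map w \<sigma> n a"
          by (auto simp: funpow_hutchinson_eq_UN_word_map)
        with match obtain b where "b \<in> B" "dist a b < \<eta>" by blast
        with a n0[OF n, of a b \<sigma>] show "\<exists>q\<in>(hutchinson w ^^ n) B. dist p q \<le> \<epsilon>"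
          unfolding funpow_hutchinson_eq_UN_word_map
          by (intro bexI[of _ "word_map w \<sigma> n b"]) auto
      next
        fix q assume "q \<in> (hutchinson w ^^ n) B"
        then obtain \<sigma> b where b: "b \<in> B" "q = word_map w \<sigma> n b"
          by (auto simp: funpow_hutchinson_eq_UN_word_map)
        with match obtain a where "a \<in> A" "dist a b < \<eta>" by blast
        with b n0[OF n, of a b \<sigma>] show "\<exists>p\<in>(hutchinson w ^^ n) A. dist p q \<le> \<epsilon>"
          unfolding funpow_hutchinson_eq_UN_word_map
          by (intro bexI[of _ "word_map w \<sigma> n a"]) auto
      qed
    qed
    then show "\<exists>n0. \<forall>n\<ge>n0. \<forall>A\<in>nonempty_compacts. \<forall>B\<in>nonempty_compacts.
        hausdorff_dist A B < \<eta> \<longrightarrow>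
        hausdorff_dist ((hutchinson w ^^ n) A) ((hutchinson w ^^ n) B) \<le> \<epsilon>"
      by blast
  qed
qed

section \<open>Orbits under a uniform local contraction of the hyperspace\<close>

text \<open>From here on only the contraction of \<open>\<eta>\<close>-close sets matters; the hypothesis \<open>contr\<close> below
  is the property established in \<open>uniform_contraction_funpow\<close>. An \<open>\<eta>\<close>-chain reduces the case of
  two arbitrary sets to finitely many applications of it.\<close>

lemma hausdorff_dist_funpow_tendsto_0:
  fixes F :: "'a::metric_space set \<Rightarrow> 'a set"
  assumes F: "\<And>n A. A \<in> nonempty_compacts \<Longrightarrow> (F ^^ n) A \<in> nonempty_compacts"
    and contr: "\<And>\<epsilon>. \<epsilon> > 0 \<Longrightarrow> \<exists>n0. \<forall>n\<ge>n0. \<forall>A\<in>nonempty_compacts. \<forall>B\<in>nonempty_compacts.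
      hausdorff_dist A B < \<eta> \<longrightarrow> hausdorff_dist ((F ^^ n) A) ((F ^^ n) B) \<le> \<epsilon>"
    and chain: "chainable \<eta> nonempty_compacts (hausdorff_dist :: 'a set \<Rightarrow> 'a set \<Rightarrow> real)"
    and A: "A \<in> nonempty_compacts" and B: "B \<in> nonempty_compacts"
  shows "(\<lambda>n. hausdorff_dist ((F ^^ n) A) ((F ^^ n) B)) \<longlonglongrightarrow> 0"
proof -
  have close: "(\<lambda>n. hausdorff_dist ((F ^^ n) P) ((F ^^ n) Q)) \<longlonglongrightarrow> 0"
    if P: "P \<in> nonempty_compacts" and Q: "Q \<in> nonempty_compacts"
      and PQ: "hausdorff_dist P Q < \<eta>" for P Q
  proof (rule LIMSEQ_I)
    fix e :: real
    assume e: "0 < e"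
    then obtain n0 where "hausdorff_dist ((F ^^ n) P) ((F ^^ n) Q) \<le> e / 2" if "n \<ge> n0" for n
      using contr[of "e / 2"] P Q PQ by (auto simp del: le_divide_eq_numeral1)
    with e hausdorff_dist_nonneg[OF F[OF P] F[OF Q]]
    show "\<exists>n0. \<forall>n\<ge>n0. norm (hausdorff_dist ((F ^^ n) P) ((F ^^ n) Q) - 0) < e"
      by (intro exI[of _ n0]) fastforce
  qed
  obtain N c where c: "c 0 = A" "c N = B" "\<And>i. i \<le> N \<Longrightarrow> c i \<in> nonempty_compacts"
    "\<And>i. i < N \<Longrightarrow> hausdorff_dist (c i) (c (Suc i)) < \<eta>"
    using chain A B unfolding chainable_def by metis
  have "(\<lambda>n. hausdorff_dist ((F ^^ n) A) ((F ^^ n) (c i))) \<longlonglongrightarrow> 0" if "i \<le> N" for i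
    using that
  proof (induction i)
    case 0
    have "hausdorff_dist C C = 0" if "C \<in> nonempty_compacts" for C :: "'a set"
      using hausdorff_dist_le_iff_matching[OF that that, of 0] hausdorff_dist_nonneg[OF that that]
      by force
    with A F c show ?case by simp
  next
    case (Suc i)
    then have Ci: "c i \<in> nonempty_compacts" "c (Suc i) \<in> nonempty_compacts" by (auto intro: c)
    have "(\<lambda>n. hausdorff_dist ((F ^^ n) A) ((F ^^ n) (c i))
             + hausdorff_dist ((F ^^ n) (c i)) ((F ^^ n) (c (Suc i)))) \<longlonglongrightarrow> 0 + 0"
      using Suc by (intro tendsto_add[OF Suc.IH close] Ci c(4)) auto
    then have lim: "(\<lambda>n. hausdorff_dist ((F ^^ n) A) ((F ^^ n) (c i))
             + hausdorff_dist ((F ^^ n) (c i)) ((F ^^ n) (c (Suc i)))) \<longlonglongrightarrow> 0"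
      by simp
    show ?case
      by (rule tendsto_sandwich[OF _ _ tendsto_const lim])
        (auto intro!: always_eventually hausdorff_dist_nonneg hausdorff_dist_triangle F A Ci)
  qed
  from this[of N] c show ?thesis by simp
qed

text \<open>Passing \<open>N\<close> steps further along the orbit costs \<open>\<eta>/2\<close>, but it also improves the closeness to
  \<open>F\<^sup>m C\<close> from \<open>\<eta>\<close> to \<open>\<eta>/2\<close>; so the bound \<open>\<eta>\<close> reproduces itself.\<close>

lemma orbit_stays_near:
  fixes F :: "'a::metric_space set \<Rightarrow> 'a set"
  assumes F: "\<And>n A. A \<in> nonempty_compacts \<Longrightarrow> (F ^^ n) A \<in> nonempty_compacts"
    and contr: "\<And>B. B \<in> nonempty_compacts \<Longrightarrow> hausdorff_dist C B < \<eta> \<Longrightarrow>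
      hausdorff_dist ((F ^^ N) C) ((F ^^ N) B) \<le> \<eta> / 2"
    and C: "C \<in> nonempty_compacts"
    and first: "\<And>r. r \<le> N \<Longrightarrow> hausdorff_dist C ((F ^^ r) C) < \<eta> / 2"
    and "0 < N"
  shows "hausdorff_dist C ((F ^^ m) C) < \<eta>"
proof (induction m rule: less_induct)
  case (less m)
  show ?case
  proof (cases "m \<le> N")
    case True
    with first[of m] hausdorff_dist_nonneg[OF C F[OF C], of m] show ?thesis by simp
  next
    case False
    then have m: "(F ^^ m) C = (F ^^ N) ((F ^^ (m - N)) C)"
      by (metis comp_apply funpow_add le_add_diff_inverse nat_le_linear)
    have "hausdorff_dist C ((F ^^ (m - N)) C) < \<eta>"
      using less False \<open>0 < N\<close> by auto
    then have "hausdorff_dist ((F ^^ N) C) ((F ^^ m) C) \<le> \<eta> / 2"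
      unfolding m by (intro contr F C)
    moreover have "hausdorff_dist C ((F ^^ m) C) \<le>
        hausdorff_dist C ((F ^^ N) C) + hausdorff_dist ((F ^^ N) C) ((F ^^ m) C)"
      by (intro hausdorff_dist_triangle F C)
    ultimately show ?thesis using first[of N] by simp
  qed
qed

lemma exists_Cauchy_orbit:
  fixes F :: "'a::metric_space set \<Rightarrow> 'a set"
  assumes F: "\<And>n A. A \<in> nonempty_compacts \<Longrightarrow> (F ^^ n) A \<in> nonempty_compacts"
    and \<eta>: "\<eta> > 0"
    and contr: "\<And>\<epsilon>. \<epsilon> > 0 \<Longrightarrow> \<exists>n0. \<forall>n\<ge>n0. \<forall>A\<in>nonempty_compacts. \<forall>B\<in>nonempty_compacts.
      hausdorff_dist A B < \<eta> \<longrightarrow> hausdorff_dist ((F ^^ n) A) ((F ^^ n) B) \<le> \<epsilon>"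
    and chain: "chainable \<eta> nonempty_compacts (hausdorff_dist :: 'a set \<Rightarrow> 'a set \<Rightarrow> real)"
  obtains C where "C \<in> nonempty_compacts"
    and "\<And>\<epsilon>. \<epsilon> > 0 \<Longrightarrow> \<exists>n. \<forall>m\<ge>n. hausdorff_dist ((F ^^ n) C) ((F ^^ m) C) \<le> \<epsilon>"
proof -
  define A :: "'a set" where "A = {undefined}"
  have A: "A \<in> nonempty_compacts" by (simp add: A_def nonempty_compacts_def)
  obtain n0 where n0: "\<forall>n\<ge>n0. \<forall>A\<in>nonempty_compacts. \<forall>B\<in>nonempty_compacts.
      hausdorff_dist A B < \<eta> \<longrightarrow> hausdorff_dist ((F ^^ n) A) ((F ^^ n) B) \<le> \<eta> / 2"
    using contr[of "\<eta> / 2"] \<eta> by auto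
  define N where "N = Suc n0"
  have "\<forall>\<^sub>F n in sequentially. \<forall>r\<in>{..N}.
      hausdorff_dist ((F ^^ n) A) ((F ^^ n) ((F ^^ r) A)) < \<eta> / 2"
    using \<eta> by (intro eventually_ball_finite ballI finite_atMost
        order_tendstoD(2)[OF hausdorff_dist_funpow_tendsto_0[OF F contr chain A F[OF A]]]) auto
  then obtain n1 where
    "\<forall>r\<in>{..N}. hausdorff_dist ((F ^^ n1) A) ((F ^^ n1) ((F ^^ r) A)) < \<eta> / 2"
    by (auto simp: eventually_sequentially)
  moreover have "(F ^^ n1) ((F ^^ r) A) = (F ^^ r) ((F ^^ n1) A)" for r
    by (metis add.commute comp_apply funpow_add)
  ultimately have first: "hausdorff_dist ((F ^^ n1) A) ((F ^^ r) ((F ^^ n1) A)) < \<eta> / 2"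
    if "r \<le> N" for r
    using that by simp
  define C where "C = (F ^^ n1) A"
  have C: "C \<in> nonempty_compacts" by (simp add: C_def F A)
  have near: "hausdorff_dist C ((F ^^ m) C) < \<eta>" for m
  proof (rule orbit_stays_near[of F C \<eta> N, OF F])
    show "hausdorff_dist ((F ^^ N) C) ((F ^^ N) B) \<le> \<eta> / 2"
      if "B \<in> nonempty_compacts" "hausdorff_dist C B < \<eta>" for B
      using n0 C that by (simp add: N_def del: funpow.simps)
    show "hausdorff_dist C ((F ^^ r) C) < \<eta> / 2" if "r \<le> N" for r
      using first[OF that] by (simp add: C_def)
  qed (auto simp: C N_def)
  have "\<exists>n. \<forall>m\<ge>n. hausdorff_dist ((F ^^ n) C) ((F ^^ m) C) \<le> \<epsilon>" if \<epsilon>: "\<epsilon> > 0" for \<epsilon>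
  proof -
    obtain n where n: "\<forall>A\<in>nonempty_compacts. \<forall>B\<in>nonempty_compacts.
        hausdorff_dist A B < \<eta> \<longrightarrow> hausdorff_dist ((F ^^ n) A) ((F ^^ n) B) \<le> \<epsilon>"
      using contr[OF \<epsilon>] by blast
    have "hausdorff_dist ((F ^^ n) C) ((F ^^ m) C) \<le> \<epsilon>" if "m \<ge> n" for m
    proof -
      have "(F ^^ m) C = (F ^^ n) ((F ^^ (m - n)) C)"
        using that by (metis comp_apply funpow_add le_add_diff_inverse)
      with n near C F show ?thesis by simp
    qed
    then show ?thesis by blast
  qed
  with C that show ?thesis by blast
qed

section \<open>The attractor\<close>

lemma hutchinson_closure_subset:
  assumes "ifs w"
  shows "hutchinson w (closure S) \<subseteq> closure (hutchinson w S)"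
proof -
  have "(\<lambda>x. w (l, x)) ` closure S \<subseteq> closure (hutchinson w S)" for l
  proof (rule image_closure_subset)
    have "continuous_on UNIV (w \<circ> Pair l)"
      using assms unfolding ifs_def
      by (intro continuous_on_compose) (auto intro!: continuous_intros intro: continuous_on_subset)
    then show "continuous_on (closure S) (\<lambda>x. w (l, x))"
      by (auto simp: o_def intro: continuous_on_subset)
    show "(\<lambda>x. w (l, x)) ` S \<subseteq> closure (hutchinson w S)"
      using closure_subset by (fastforce simp: hutchinson_def)
  qed simp
  then show ?thesis by (auto simp: hutchinson_def)
qed

text \<open>The closed set \<open>F K\<close> contains all \<open>F\<^sup>n K\<close> with \<open>n > 0\<close>, hence also their limit.\<close>

lemma hutchinson_fixed_if_tendsto:
  fixes w :: "'l::metric_space \<times> 'a::metric_space \<Rightarrow> 'a"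
  assumes compact: "compact (UNIV :: 'l set)" and w: "ifs w"
    and K: "K \<in> nonempty_compacts" and sub: "hutchinson w K \<subseteq> K"
    and lim: "(\<lambda>n. hausdorff_dist ((hutchinson w ^^ n) K) K) \<longlonglongrightarrow> 0"
  shows "hutchinson w K = K"
proof
  have FK: "(hutchinson w ^^ n) K \<in> nonempty_compacts" for n
    using compact w K by (rule funpow_hutchinson_nonempty_compacts)
  have FK1: "closed (hutchinson w K)" "hutchinson w K \<noteq> {}"
    using FK[of 1] by (auto simp: nonempty_compacts_def compact_imp_closed)
  show "K \<subseteq> hutchinson w K"
  proof
    fix x assume x: "x \<in> K"
    have "infdist x (hutchinson w K) \<le> hausdorff_dist ((hutchinson w ^^ n) K) K" if "n \<ge> 1" for n
    proof -
      have "infdist x (hutchinson w K) \<le> infdist x ((hutchinson w ^^ n) K)"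
        using funpow_hutchinson_antimono[OF sub that] FK[of n]
        by (intro infdist_mono) (auto simp: nonempty_compacts_def)
      also have "\<dots> \<le> hausdorff_dist ((hutchinson w ^^ n) K) K"
        using hausdorff_dist_le_iff[OF FK K] x by blast
      finally show ?thesis .
    qed
    then have "infdist x (hutchinson w K) \<le> 0"
      by (intro LIMSEQ_le_const[OF lim]) blast
    then have "infdist x (hutchinson w K) = 0"
      using infdist_nonneg[of x "hutchinson w K"] by simp
    then show "x \<in> hutchinson w K"
      using in_closed_iff_infdist_zero[OF FK1] by blast
  qed
qed (rule sub)

theorem theorem4:
  fixes w :: "'l::metric_space \<times> 'a::complete_space \<Rightarrow> 'a"
  assumes "compact (UNIV :: 'l set)"
    and "ifs w"
    and "weakly_star_hyperbolic w"
    and "\<And>\<epsilon>. \<epsilon> > 0 \<Longrightarrow> chainable \<epsilon> (nonempty_compacts :: 'a set set) hausdorff_dist"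
  shows "\<exists>K\<in>nonempty_compacts. global_attractor w K \<and> hutchinson w K = K"
proof -
  let ?F = "hutchinson w"
  have F: "(?F ^^ n) A \<in> nonempty_compacts" if "A \<in> nonempty_compacts" for n A
    using assms(1,2) that by (rule funpow_hutchinson_nonempty_compacts)
  obtain \<eta> where \<eta>: "\<eta> > 0"
    and contr: "\<And>\<epsilon>. \<epsilon> > 0 \<Longrightarrow> \<exists>n0. \<forall>n\<ge>n0. \<forall>A\<in>nonempty_compacts. \<forall>B\<in>nonempty_compacts.
      hausdorff_dist A B < \<eta> \<longrightarrow> hausdorff_dist ((?F ^^ n) A) ((?F ^^ n) B) \<le> \<epsilon>"
    using uniform_contraction_funpow[OF assms(1-3)] by metis
  note chain = assms(4)[OF \<eta>]
  obtain C where C: "C \<in> nonempty_compacts"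
    and Cauchy: "\<And>\<epsilon>. \<epsilon> > 0 \<Longrightarrow> \<exists>n. \<forall>m\<ge>n. hausdorff_dist ((?F ^^ n) C) ((?F ^^ m) C) \<le> \<epsilon>"
    using exists_Cauchy_orbit[OF F \<eta> contr chain] by metis
  define D where "D = closure (\<Union>n. (?F ^^ n) C)"
  have "compact D"
    unfolding D_def by (intro compact_closure_Union_if_Cauchy F C Cauchy)
  moreover have "C \<subseteq> D"
    unfolding D_def
    by (rule order_trans[OF _ closure_subset]) (auto intro: UN_I[of 0])
  ultimately have D: "D \<in> nonempty_compacts"
    using C by (auto simp: nonempty_compacts_def)
  have "?F (\<Union>n. (?F ^^ n) C) = (\<Union>n. (?F ^^ Suc n) C)"
    by (auto simp: hutchinson_def)
  also have "\<dots> \<subseteq> (\<Union>n. (?F ^^ n) C)" by blast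
  finally have "?F D \<subseteq> D"
    unfolding D_def by (meson assms(2) closure_mono hutchinson_closure_subset order_trans)
  note dec = funpow_hutchinson_antimono[OF this]
  define K where "K = (\<Inter>n. (?F ^^ n) D)"
  have K: "K \<in> nonempty_compacts" and D_lim: "(\<lambda>n. hausdorff_dist ((?F ^^ n) D) K) \<longlonglongrightarrow> 0"
    unfolding K_def using decreasing_compacts_tendsto_Inter[of "\<lambda>n. (?F ^^ n) D"] F D dec by auto
  have lim: "(\<lambda>n. hausdorff_dist ((?F ^^ n) B) K) \<longlonglongrightarrow> 0" if B: "B \<in> nonempty_compacts" for B
  proof -
    have "(\<lambda>n. hausdorff_dist ((?F ^^ n) B) ((?F ^^ n) D)
             + hausdorff_dist ((?F ^^ n) D) K) \<longlonglongrightarrow> 0 + 0"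
      by (intro tendsto_add D_lim hausdorff_dist_funpow_tendsto_0[OF F contr chain] B D)
    then have sum: "(\<lambda>n. hausdorff_dist ((?F ^^ n) B) ((?F ^^ n) D)
             + hausdorff_dist ((?F ^^ n) D) K) \<longlonglongrightarrow> 0"
      by simp
    show ?thesis
      by (rule tendsto_sandwich[OF _ _ tendsto_const sum])
        (auto intro!: always_eventually hausdorff_dist_nonneg hausdorff_dist_triangle F B D K)
  qed
  have "?F K \<subseteq> (?F ^^ n) D" for n
  proof -
    have "?F K \<subseteq> (?F ^^ Suc n) D"
      unfolding funpow.simps comp_apply by (rule hutchinson_mono) (auto simp: K_def)
    also have "\<dots> \<subseteq> (?F ^^ n) D" by (rule dec) simp
    finally show ?thesis .
  qed
  then have "?F K \<subseteq> K" by (auto simp: K_def)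
  then have "?F K = K"
    by (rule hutchinson_fixed_if_tendsto[OF assms(1,2) K _ lim[OF K]])
  with K lim show ?thesis
    unfolding global_attractor_def by blast
qed

end
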